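(* Let $f,g\in L^1$. Then $f$ and $g$ are orthogonal in the $L^1$ sense if and only if $$\|f+g\|_1=\|f\|_1+\|g\|_1 .$$
   Context: $L^1$ is the space of (real-valued) integrable functions with norm $\|f\|_1=\int|f(x)|\,dx$, with dual $L^\infty$. The function $\operatorname{sign}$ takes the values $1,0,-1$ on positive, zero and negative numbers respectively. Weak inner product in $L^1$: for $f,g\in L^1$, $$\langle f,g\rangle_1=\tfrac12\int f(x)\big(\operatorname{sign}(f(x)+g(x))-\operatorname{sign}(f(x))\big)+g(x)\big(\operatorname{sign}(f(x)+g(x))-\operatorname{sign}(g(x))\big)\,dx .$$ Angle in $L^1$: $\theta_{f,g}=\operatorname{arccot}\langle f,g\rangle_1$. Orthogonality in $L^1$: $f$ and $g$ are orthogonal in the $L^1$ sense if and only if $\langle f,g\rangle_1=0$ (equivalently, the angle equals $\pi/2$). *)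

theory Defs
  imports "HOL-Analysis.Analysis"
begin

text \<open>
  Elements of \<open>L\<^sup>1\<close> are represented by real-valued functions that are integrable with respect
  to a measure \<open>M\<close>. All notions below depend only on the almost-everywhere class of their
  arguments. The case of Lebesgue measure is \<open>M = lebesgue\<close> or \<open>M = lebesgue_on S\<close>.
\<close>

definition L1_norm :: "'a measure \<Rightarrow> ('a \<Rightarrow> real) \<Rightarrow> real" where
  "L1_norm M f = (LINT x|M. \<bar>f x\<bar>)"

definition L1_weak_inner :: "'a measure \<Rightarrow> ('a \<Rightarrow> real) \<Rightarrow> ('a \<Rightarrow> real) \<Rightarrow> real" where
  "L1_weak_inner M f g =
     1 / 2 * (LINT x|M. f x * (sgn (f x + g x) - sgn (f x)) + g x * (sgn (f x + g x) - sgn (g x)))"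

definition L1_orthogonal :: "'a measure \<Rightarrow> ('a \<Rightarrow> real) \<Rightarrow> ('a \<Rightarrow> real) \<Rightarrow> bool" where
  "L1_orthogonal M f g \<longleftrightarrow> L1_weak_inner M f g = 0"

end

theory Submission
  imports Defs
begin

text \<open>Since \<open>t * sgn t = \<bar>t\<bar>\<close>, the two terms with
  \<open>sgn (f x + g x)\<close> merge into \<open>\<bar>f x + g x\<bar>\<close>. Hence the weak
  inner product is, up to sign, half the gap in the triangle inequality for \<open>L1_norm\<close>
  (\<open>L1_weak_inner_eq\<close>), and it vanishes exactly when there is equality.\<close>

lemma L1_weak_inner_eq:
  assumes "integrable M f" and "integrable M g"
  shows "L1_weak_inner M f g = (L1_norm M (\<lambda>x. f x + g x) - L1_norm M f - L1_norm M g) / 2"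
proof -
  have "f x * (sgn (f x + g x) - sgn (f x)) + g x * (sgn (f x + g x) - sgn (g x))
      = \<bar>f x + g x\<bar> - \<bar>f x\<bar> - \<bar>g x\<bar>" for x
    by (simp add: abs_sgn algebra_simps)
  \<comment> \<open>Integrability lets the integral of the pointwise identity split into three;
    Bochner integrals of non-integrable functions default to 0.\<close>
  then show ?thesis
    using assms by (simp add: L1_weak_inner_def L1_norm_def)
qed

theorem theorem3:
  fixes M :: "'a measure" and f g :: "'a \<Rightarrow> real"
  assumes "integrable M f" and "integrable M g"
  shows "L1_orthogonal M f g \<longleftrightarrow> L1_norm M (\<lambda>x. f x + g x) = L1_norm M f + L1_norm M g"
  using L1_weak_inner_eq[OF assms] by (auto simp: L1_orthogonal_def)

end
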